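(* Let $n,w,t$ be integers with $t\le w$ and $t\le 2w-t\le n$, and let $q\ge 3$. Define $$A'_q(n,w,t)=\{(a_1,\dots,a_n)\in\mathbb{Z}_q^n:\ \mathrm{wt}((a_1,\dots,a_t))=t,\ \mathrm{wt}((a_{t+1},\dots,a_n))=w-t\}.$$ Then: (1') $|A'_q(n,w,t)|=\binom{n-t}{w-t}(q-1)^w$; (2') $A'_q(n,w,t)$ is an anticode of diameter $2w-t$ in $J_q(n,w)$; (3') if $n\ge (w-t+1)(t+1)$, then for all sufficiently large $q$, $A'_q(n,w,t)$ is a maximum anticode of diameter $2w-t$ in $J_q(n,w)$ (i.e. no subset of $J_q(n,w)$ of diameter at most $2w-t$ has more elements).
   Context: $\mathbb{Z}_q=\{0,1,\dots,q-1\}$ is used merely as an alphabet. For $x\in\mathbb{Z}_q^n$, $\mathrm{supp}(x)=\{i\in[n]: x_i\ne 0\}$ and $\mathrm{wt}(x)=|\mathrm{supp}(x)|$; $d(x,y)$ is the Hamming distance (number of positions where $x,y$ differ). $J_q(n,w)$ denotes the set of words of $\mathbb{Z}_q^n$ of weight $w$, with the Hamming metric. An anticode of diameter $D$ is a nonempty subset in which all pairwise distances are at most $D$; it is maximum if it has the largest cardinality among all anticodes of diameter $D$ in the space. *)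

theory Defs
  imports Main
begin

text \<open>Words of length n over the alphabet Z_q = {0,...,q-1}, represented as functions
  nat => nat with positions 0..n-1 (position i here is coordinate i+1 of the paper),
  values below q, and value 0 outside the positions.\<close>
definition words :: "nat \<Rightarrow> nat \<Rightarrow> (nat \<Rightarrow> nat) set" where
  "words q n = {x. (\<forall>i<n. x i < q) \<and> (\<forall>i\<ge>n. x i = 0)}"

definition supp :: "nat \<Rightarrow> (nat \<Rightarrow> nat) \<Rightarrow> nat set" where
  "supp n x = {i. i < n \<and> x i \<noteq> 0}"

definition wt :: "nat \<Rightarrow> (nat \<Rightarrow> nat) \<Rightarrow> nat" where
  "wt n x = card (supp n x)"

definition hdist :: "nat \<Rightarrow> (nat \<Rightarrow> nat) \<Rightarrow> (nat \<Rightarrow> nat) \<Rightarrow> nat" where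
  "hdist n x y = card {i. i < n \<and> x i \<noteq> y i}"

definition Jq :: "nat \<Rightarrow> nat \<Rightarrow> nat \<Rightarrow> (nat \<Rightarrow> nat) set" where
  "Jq q n w = {x \<in> words q n. wt n x = w}"

definition anticode :: "nat \<Rightarrow> (nat \<Rightarrow> nat) set \<Rightarrow> nat \<Rightarrow> (nat \<Rightarrow> nat) set \<Rightarrow> bool" where
  "anticode n X D S \<longleftrightarrow> S \<noteq> {} \<and> S \<subseteq> X \<and> (\<forall>x\<in>S. \<forall>y\<in>S. hdist n x y \<le> D)"

definition max_anticode :: "nat \<Rightarrow> (nat \<Rightarrow> nat) set \<Rightarrow> nat \<Rightarrow> (nat \<Rightarrow> nat) set \<Rightarrow> bool" where
  "max_anticode n X D S \<longleftrightarrow> anticode n X D S \<and> (\<forall>T. anticode n X D T \<longrightarrow> card T \<le> card S)"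

definition Aprime :: "nat \<Rightarrow> nat \<Rightarrow> nat \<Rightarrow> nat \<Rightarrow> (nat \<Rightarrow> nat) set" where
  "Aprime q n w t = {x \<in> words q n. card {i. i < t \<and> x i \<noteq> 0} = t
                      \<and> card {i. t \<le> i \<and> i < n \<and> x i \<noteq> 0} = w - t}"

end

theory Submission
  imports Defs "HOL-Library.FuncSet"
begin

text \<open>Two words of weight \<open>w\<close> that never agree on a nonzero entry have distance \<open>2w\<close> minus the size of
  the intersection of their supports. For large \<open>q\<close> the cardinality of an anticode is therefore
  governed by the number of supports that carry many words, and these supports form a
  \<open>t\<close>-intersecting family of \<open>w\<close>-sets, of size at most \<open>(n - t) choose (w - t)\<close> by Wilson's
  Erdos-Ko-Rado theorem.

  Wilson's theorem is obtained by a variant of the generating-set method of Ahlswede and Khachatrian.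
  A family of traces on the first \<open>l\<close> points is weighted by the number of \<open>k\<close>-sets extending them, and
  the last point is removed without losing weight: after shifting, two traces that stop being
  \<open>t\<close>-intersecting together cover all remaining points, so that their sizes are complementary, and
  it suffices to compare complementary levels. At \<open>l = t\<close> only the full set is left.\<close>

section \<open>Weighted families of traces and binomial inequalities\<close>

definition intersecting :: "nat \<Rightarrow> 'a set set \<Rightarrow> bool" where
  "intersecting t U \<longleftrightarrow> (\<forall>g\<in>U. \<forall>h\<in>U. t \<le> card (g \<inter> h))"

text \<open>The number of \<open>k\<close>-sets with a prescribed trace of size \<open>s\<close>, when \<open>m\<close> points lie outside the
  domain of the traces.\<close>
definition ext_count :: "nat \<Rightarrow> nat \<Rightarrow> nat \<Rightarrow> nat" where
  "ext_count k m s = (if s \<le> k then m choose (k - s) else 0)"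

text \<open>Pascal's rule: the extending set either avoids the additional point or takes it into its
  trace.\<close>

lemma ext_count_Suc: "ext_count k (Suc m) s = ext_count k m s + ext_count k m (Suc s)"
proof -
  consider "s < k" | "s = k" | "s > k" by linarith
  then show ?thesis
  proof cases
    case 1
    then obtain j where "k = Suc (s + j)" using less_imp_Suc_add by blast
    then show ?thesis by (simp add: ext_count_def Suc_diff_le)
  qed (auto simp: ext_count_def)
qed

text \<open>Since \<open>Suc a * (m choose Suc a) = (m - a) * (m choose a)\<close>, the claim
  reduces to \<open>Suc b \<le> m - a\<close> and \<open>Suc a \<le> m - b\<close>, which the
  hypothesis supplies.\<close>

lemma binomial_mult_Suc_le:
  assumes "Suc a + Suc b \<le> Suc m"
  shows "(m choose a) * (m choose b) \<le> (m choose Suc a) * (m choose Suc b)"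
proof -
  have A: "Suc a * (m choose Suc a) = (m - a) * (m choose a)" for a
    using binomial_absorb_comp[of m a] by (metis binomial_absorption)
  have "(Suc b * Suc a) * ((m choose a) * (m choose b)) \<le> ((m - a) * (m - b)) * ((m choose a) * (m choose b))"
    using assms by (intro mult_right_mono mult_mono) auto
  also have "\<dots> = (Suc a * (m choose Suc a)) * (Suc b * (m choose Suc b))"
    by (simp only: A) (simp add: ac_simps)
  also have "\<dots> = (Suc b * Suc a) * ((m choose Suc a) * (m choose Suc b))"
    by (simp only: ac_simps)
  finally show ?thesis by (simp only: mult_le_cancel1) simp
qed

text \<open>For complementary levels \<open>s\<close> and \<open>s'\<close> this excludes that each
  is too light to make up for dropping the other. With \<open>k - s = Suc a\<close> and
  \<open>k - s' = Suc b\<close> it is the preceding inequality; if \<open>s\<close> or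
  \<open>s'\<close> is at least \<open>k\<close>, the left side vanishes.\<close>

lemma ext_count_mult_le:
  assumes "2 * k \<le> m + s + s' + 1"
  shows "ext_count k m (Suc s) * ext_count k m (Suc s') \<le> ext_count k m s * ext_count k m s'"
proof (cases "s < k \<and> s' < k")
  case True
  then obtain a b where ab: "k = Suc (s + a)" "k = Suc (s' + b)"
    using less_imp_Suc_add by metis
  have "k - s = Suc a" "k - Suc s = a" "k - s' = Suc b" "k - Suc s' = b" using ab by auto
  moreover have "Suc a + Suc b \<le> Suc m" using ab assms by linarith
  ultimately show ?thesis using True binomial_mult_Suc_le[of a b m]
    by (simp add: ext_count_def)
qed (auto simp: ext_count_def)

section \<open>Selecting among conflicting traces\<close>

text \<open>Averaging: each \<open>g\<close> misses \<open>p - s\<close> of the \<open>p\<close>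
  points, so some point is missed by at least the average number of members.\<close>

lemma exists_often_avoided:
  assumes "finite E" "p > 0" and E: "\<And>g. g \<in> E \<Longrightarrow> g \<subseteq> {..<p} \<and> card g = s"
  shows "\<exists>a<p. card E * (p - s) \<le> p * card {g\<in>E. a \<notin> g}"
proof (rule ccontr)
  assume "\<not> ?thesis"
  then have lt: "p * card {g\<in>E. a \<notin> g} < card E * (p - s)" if "a < p" for a
    using that not_le by blast
  have "(\<Sum>a<p. card {g\<in>E. a \<notin> g}) = (\<Sum>a<p. \<Sum>g\<in>E. if a \<notin> g then 1 else 0)"
    using \<open>finite E\<close> by (intro sum.cong refl) (simp flip: sum.inter_filter)
  also have "\<dots> = (\<Sum>g\<in>E. \<Sum>a<p. if a \<notin> g then 1 else 0)" by (rule sum.swap)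
  also have "\<dots> = (\<Sum>g\<in>E. p - s)"
  proof (rule sum.cong[OF refl])
    fix g assume "g \<in> E"
    have "(\<Sum>a<p. if a \<notin> g then 1 else 0) = card {a\<in>{..<p}. a \<notin> g}"
      by (simp flip: sum.inter_filter)
    also have "{a\<in>{..<p}. a \<notin> g} = {..<p} - g" by auto
    also have "card ({..<p} - g) = p - s"
      using E[OF \<open>g \<in> E\<close>] finite_subset[of g "{..<p}"] by (simp add: card_Diff_subset)
    finally show "(\<Sum>a<p. if a \<notin> g then 1 else 0) = p - s" .
  qed
  finally have "(\<Sum>a<p. p * card {g\<in>E. a \<notin> g}) = p * (card E * (p - s))"
    by (simp flip: sum_distrib_left)
  moreover have "(\<Sum>a<p. p * card {g\<in>E. a \<notin> g}) < (\<Sum>a<p. card E * (p - s))"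
    using lt \<open>p > 0\<close> by (intro sum_strict_mono) auto
  ultimately show False by simp
qed

text \<open>Keeping only the sets that avoid a suitable point costs at most a factor
  \<open>(p - s) / p\<close>, while for \<open>s < k\<close> the weight grows by the factor
  \<open>(m + 1) / (k - s)\<close>. The bound on \<open>m + p + 1\<close> makes the product of the
  two at least 1.\<close>

lemma middle_level_gain:
  assumes "1 \<le> t" "t \<le> p" "t \<le> k" "(t + 1) * (k - t + 1) \<le> m + p + 1" "s + s + 1 = p + t"
    and T: "e * (p - s) \<le> p * T"
  shows "e * ext_count k m (Suc s) \<le> T * ext_count k (Suc m) s"
proof (cases "s < k")
  case True
  then obtain j where j: "k = Suc (s + j)" using less_imp_Suc_add by blast
  obtain u where u: "t = Suc u" using \<open>1 \<le> t\<close> by (cases t) auto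
  obtain r where r: "p = s + Suc r" using assms(2,5) less_imp_Suc_add[of s p] u by auto
  have s: "s = u + Suc r" using assms(5) r u by linarith
  have K: "k - t + 1 = Suc r + Suc j" using j s u by linarith
  \<comment> \<open>Here \<open>p = u + 2 * Suc r\<close> and \<open>t + 1 = u + 2\<close>, hence
    \<open>p \<le> Suc r * (t + 1)\<close>.\<close>
  have "p * (Suc r + Suc j) \<le> Suc r * ((t + 1) * (Suc r + Suc j))"
    unfolding r s u by (simp add: algebra_simps)
  also have "\<dots> \<le> Suc r * (m + p + 1)"
    using assms(4) unfolding K by (rule mult_left_mono) simp
  \<comment> \<open>The product of \<open>p\<close> and \<open>Suc r\<close> occurs on both sides
    and cancels.\<close>
  finally have num: "p * Suc j \<le> Suc r * Suc m" by (simp add: algebra_simps)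
  have "(p * Suc j) * (e * (m choose j)) = (e * (m choose j)) * (p * Suc j)" by simp
  also have "\<dots> \<le> (e * (m choose j)) * (Suc r * Suc m)" using num by (rule mult_left_mono) simp
  also have "\<dots> = (e * Suc r) * (Suc m * (m choose j))" by (simp only: ac_simps)
  also have "\<dots> = (e * Suc r) * (Suc j * (Suc m choose Suc j))"
    by (simp only: Suc_times_binomial_eq ac_simps)
  also have "\<dots> \<le> (p * T) * (Suc j * (Suc m choose Suc j))"
    using T r by (intro mult_right_mono) auto
  finally have "(p * Suc j) * (e * (m choose j)) \<le> (p * Suc j) * (T * (Suc m choose Suc j))"
    by (simp only: ac_simps)
  moreover have "p * Suc j > 0" using r by simp
  ultimately have "e * (m choose j) \<le> T * (Suc m choose Suc j)"
    by (simp only: mult_le_cancel1)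
  moreover have "k - s = Suc j" "k - Suc s = j" using j by auto
  ultimately show ?thesis using True by (simp add: ext_count_def)
qed (auto simp: ext_count_def)

lemma sum_card_const:
  assumes "\<And>g. g \<in> E \<Longrightarrow> card g = s"
  shows "(\<Sum>g\<in>E. f (card g)) = card E * (f s :: nat)"
  using assms by simp

text \<open>Only pairs of complementary levels, of sizes \<open>s\<close> and \<open>p + t - 1 - s\<close>, conflict. Of two different
  levels one keeps the better one; in the middle level one keeps the sets that avoid a fixed point.\<close>
lemma selection:
  assumes par: "1 \<le> t" "t \<le> p" "t \<le> k" "(t + 1) * (k - t + 1) \<le> m + p + 1"
    and "D \<subseteq> Pow {..<p}"
    and "\<And>g h. g \<in> D \<Longrightarrow> h \<in> D \<Longrightarrow> t \<le> card (g \<inter> h) \<or> (g \<union> h = {..<p} \<and> card g + card h + 1 = p + t)"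
  shows "\<exists>D'\<subseteq>D. intersecting t D' \<and>
    (\<Sum>g\<in>D. ext_count k m (Suc (card g))) \<le> (\<Sum>g\<in>D'. ext_count k (Suc m) (card g))"
  using assms(5,6)
proof (induction "card D" arbitrary: D rule: less_induct)
  case less
  note conf = less.prems(2)
  have fin: "finite D" using less.prems(1) by (meson finite_Pow_iff finite_lessThan finite_subset)
  show ?case
  proof (cases "D = {}")
    case False
    then obtain g0 where g0: "g0 \<in> D" by blast
    define s where "s = card g0"
    define L where "L = (\<lambda>s. {g\<in>D. card g = s})"
    \<comment> \<open>Sets of these two sizes conflict only with each other, so \<open>E\<close> is
      settled on its own and the induction hypothesis handles \<open>D - E\<close>.\<close>
    define E where "E = {g\<in>D. card g = s \<or> card g + s + 1 = p + t}"
    have "finite E" using fin by (simp add: E_def)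
    have "\<exists>E'\<subseteq>E. intersecting t E' \<and>
      (\<Sum>g\<in>E. ext_count k m (Suc (card g))) \<le> (\<Sum>g\<in>E'. ext_count k (Suc m) (card g))"
    proof -
      consider "s + 1 > p + t" | "s + s + 1 = p + t" | "s + 1 \<le> p + t" "s + s + 1 \<noteq> p + t" by linarith
      then show ?thesis
      proof cases
        case 1
        have "t \<le> card (g \<inter> h)" if "g \<in> E" "h \<in> E" for g h
          using that conf[of g h] 1 by (auto simp: E_def)
        then have "intersecting t E" by (simp add: intersecting_def)
        moreover have "(\<Sum>g\<in>E. ext_count k m (Suc (card g))) \<le> (\<Sum>g\<in>E. ext_count k (Suc m) (card g))"
          by (rule sum_mono) (simp add: ext_count_Suc)
        ultimately show ?thesis by blast
      next
        case 2
        have E: "g \<in> D" "card g = s" "g \<subseteq> {..<p}" if "g \<in> E" for g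
          using that 2 less.prems(1) by (auto simp: E_def)
        obtain a where a: "a < p" "card E * (p - s) \<le> p * card {g\<in>E. a \<notin> g}"
          using exists_often_avoided[of E p s] E(2,3) \<open>finite E\<close> par by auto
        define E' where "E' = {g\<in>E. a \<notin> g}"
        have "intersecting t E'" unfolding intersecting_def
        proof (intro ballI)
          fix g h assume "g \<in> E'" "h \<in> E'"
          then have "a \<notin> g \<union> h" "g \<in> D" "h \<in> D" using E by (auto simp: E'_def)
          \<comment> \<open>A conflicting pair would cover \<open>{..<p}\<close>, including
            \<open>a\<close>.\<close>
          then show "t \<le> card (g \<inter> h)" using conf[of g h] \<open>a < p\<close> by blast
        qed
        moreover have "card E * ext_count k m (Suc s) \<le> card E' * ext_count k (Suc m) s"
          using middle_level_gain[OF par 2 a(2)] by (simp add: E'_def)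
        ultimately show ?thesis using E
          by (intro exI[of _ E']) (auto simp: E'_def)
      next
        case 3
        \<comment> \<open>The subtraction is exact because \<open>s + 1 \<le> p + t\<close> in this
          case.\<close>
        define s' where "s' = p + t - 1 - s"
        have s': "s + s' + 1 = p + t" "s' \<noteq> s" using 3 by (auto simp: s'_def)
        have E_un: "E = L s \<union> L s'" using s' by (auto simp: E_def L_def)
        have disj: "L s \<inter> L s' = {}" using s' by (auto simp: L_def)
        have finL: "finite (L r)" for r using fin by (simp add: L_def)
        have sumL: "(\<Sum>g\<in>L r. f (card g)) = card (L r) * f r" for r and f :: "nat \<Rightarrow> nat"
          by (rule sum_card_const) (simp add: L_def)
        have "t \<le> card (g \<inter> h)" if "r = s \<or> r = s'" "g \<in> L r" "h \<in> L r" for g h r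
        proof -
          have "g \<in> D" "h \<in> D" "card g = r" "card h = r" using that by (auto simp: L_def)
          moreover have "r + r + 1 \<noteq> p + t" using that(1) s' by linarith
          ultimately show ?thesis using conf[of g h] by metis
        qed
        then have intL: "intersecting t (L s)" "intersecting t (L s')"
          unfolding intersecting_def by blast+
        have lhs: "(\<Sum>g\<in>E. ext_count k m (Suc (card g)))
            = card (L s) * ext_count k m (Suc s) + card (L s') * ext_count k m (Suc s')"
          unfolding E_un
          using sum.union_disjoint[OF finL finL disj, of "\<lambda>g. ext_count k m (Suc (card g))"]
            sumL[of "\<lambda>x. ext_count k m (Suc x)"] by simp
        \<comment> \<open>Expanding the product and using \<open>1 \<le> t\<close> gives
          \<open>2 * k \<le> m + p + t\<close>, the condition of the product inequality for
          complementary levels.\<close>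
        have "(k - t) + t * (k - t) + t + 1 \<le> m + p + 1" using par(4) by simp
        moreover have "1 * (k - t) \<le> t * (k - t)" using par(1) by (rule mult_right_mono) simp
        ultimately have "2 * (k - t) + t \<le> m + p" by linarith
        then have bound: "2 * k \<le> m + s + s' + 1" using s' par by linarith
        have rhs: "(\<Sum>g\<in>L r. ext_count k (Suc m) (card g))
            = card (L r) * ext_count k m r + card (L r) * ext_count k m (Suc r)" for r
          unfolding sumL by (simp add: ext_count_Suc distrib_left)
        note mult = ext_count_mult_le[OF bound]
        \<comment> \<open>By Pascal's rule, keeping \<open>L s\<close> alone gains
          \<open>card (L s) * ext_count k m s\<close>, which has to pay for dropping
          \<open>L s'\<close>; likewise with the levels exchanged.\<close>
        show ?thesis
        proof (cases "card (L s') * ext_count k m (Suc s') \<le> card (L s) * ext_count k m s")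
          case True
          then show ?thesis
            by (intro exI[of _ "L s"])
               (use intL in \<open>simp add: lhs rhs, simp add: E_un\<close>)
        next
          case a: False
          show ?thesis
          proof (cases "card (L s) * ext_count k m (Suc s) \<le> card (L s') * ext_count k m s'")
            case True
            then show ?thesis
              by (intro exI[of _ "L s'"])
                 (use intL in \<open>simp add: lhs rhs, simp add: E_un\<close>)
          next
            case False
            \<comment> \<open>If neither level can pay for the other, the product of the two strict
              inequalities contradicts \<open>mult\<close>.\<close>
            have "(card (L s) * ext_count k m s) * (card (L s') * ext_count k m s')
               < (card (L s') * ext_count k m (Suc s')) * (card (L s) * ext_count k m (Suc s))"
              using a False unfolding not_le by (rule mult_strict_mono') simp_all
            then have "(card (L s) * card (L s')) * (ext_count k m s * ext_count k m s')
               < (card (L s) * card (L s')) * (ext_count k m (Suc s) * ext_count k m (Suc s'))"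
              by (simp only: ac_simps)
            then show ?thesis using mult by (simp add: not_less[symmetric])
          qed
        qed
      qed
    qed
    then obtain E' where E': "E' \<subseteq> E" "intersecting t E'"
      "(\<Sum>g\<in>E. ext_count k m (Suc (card g))) \<le> (\<Sum>g\<in>E'. ext_count k (Suc m) (card g))" by blast
    have "E \<subseteq> D" "g0 \<in> E" using g0 by (auto simp: E_def s_def)
    then have "card (D - E) < card D" using fin g0 by (intro psubset_card_mono) auto
    then obtain D' where D': "D' \<subseteq> D - E" "intersecting t D'"
      "(\<Sum>g\<in>D-E. ext_count k m (Suc (card g))) \<le> (\<Sum>g\<in>D'. ext_count k (Suc m) (card g))"
      using less.hyps[of "D - E"] less.prems by blast
    have cross: "t \<le> card (g \<inter> h)" if "g \<in> E" "h \<in> D - E" for g h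
    proof -
      have "g \<in> D" "h \<in> D" "card g = s \<or> card g + s + 1 = p + t"
        and "card h \<noteq> s" "card h + s + 1 \<noteq> p + t" using that by (simp_all add: E_def)
      then have "card g + card h + 1 \<noteq> p + t" by linarith
      then show ?thesis using conf[OF \<open>g \<in> D\<close> \<open>h \<in> D\<close>] by blast
    qed
    have "t \<le> card (g \<inter> h)" "t \<le> card (h \<inter> g)" if "g \<in> E'" "h \<in> D'" for g h
    proof -
      show "t \<le> card (g \<inter> h)" using cross that E'(1) D'(1) by blast
      then show "t \<le> card (h \<inter> g)" by (simp only: Int_commute)
    qed
    then have "intersecting t (E' \<union> D')"
      using E'(2) D'(2) unfolding intersecting_def by blast
    moreover have "(\<Sum>g\<in>D. ext_count k m (Suc (card g))) \<le> (\<Sum>g\<in>E' \<union> D'. ext_count k (Suc m) (card g))"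
    proof -
      have "finite E'" "finite D'" "E' \<inter> D' = {}"
        using E'(1) D'(1) \<open>E \<subseteq> D\<close> fin by (auto intro: finite_subset)
      then show ?thesis
        using sum.subset_diff[OF \<open>E \<subseteq> D\<close> fin, of "\<lambda>g. ext_count k m (Suc (card g))"] E'(3) D'(3)
        by (simp add: sum.union_disjoint)
    qed
    ultimately show ?thesis using E'(1) D'(1) \<open>E \<subseteq> D\<close> by (intro exI[of _ "E' \<union> D'"]) auto
  qed (auto simp: intersecting_def)
qed

section \<open>Shifting and stable families\<close>

definition shift :: "'a \<Rightarrow> 'a \<Rightarrow> 'a set set \<Rightarrow> 'a set \<Rightarrow> 'a set" where
  "shift p a V g = (if p \<in> g \<and> a \<notin> g \<and> insert a (g - {p}) \<notin> V then insert a (g - {p}) else g)"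

text \<open>A moved set lands outside \<open>V\<close>, so it cannot collide with an unmoved one;
  two moved sets are recovered by exchanging \<open>a\<close> back for \<open>p\<close>.\<close>

lemma inj_on_shift: "inj_on (shift p a V) V"
proof (rule inj_onI)
  fix g h assume "g \<in> V" "h \<in> V" "shift p a V g = shift p a V h"
  then show "g = h" unfolding shift_def
    by (auto split: if_splits)
qed

lemma card_exchange:
  assumes "finite X" "p \<in> X" "a \<notin> X"
  shows "card (insert a (X - {p})) = card X"
proof -
  have "card (insert a (X - {p})) = Suc (card (X - {p}))" using assms by (intro card_insert_disjoint) auto
  then show ?thesis using card_Suc_Diff1[OF assms(1,2)] by (rule trans)
qed

lemma card_shift: "finite g \<Longrightarrow> card (shift p a V g) = card g"
  by (auto simp: shift_def card_exchange simp del: card_insert_disjoint)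

text \<open>The critical pair is a moved \<open>g\<close> and an unmoved \<open>h\<close> containing
  \<open>p\<close> but not \<open>a\<close>. Such an \<open>h\<close> stays only because its
  exchanged set already lies in \<open>V\<close>, and that set meets \<open>g\<close> exactly where
  \<open>h\<close> meets the moved \<open>g\<close>.\<close>

lemma intersecting_shift:
  assumes "intersecting t V" "\<And>g. g \<in> V \<Longrightarrow> finite g" "a \<noteq> p"
  shows "intersecting t (shift p a V ` V)"
proof -
  have I: "t \<le> card (g \<inter> h)" if "g \<in> V" "h \<in> V" for g h
    using assms(1) that by (auto simp: intersecting_def)
  note sw = card_exchange[where a = a and p = p]
  have moved: "t \<le> card (insert a (g - {p}) \<inter> h)"
    if g: "g \<in> V" "p \<in> g" "a \<notin> g" and h: "h \<in> V" "shift p a V h = h" for g h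
  proof -
    have f: "finite g" "finite h" using assms(2) g h by auto
    consider "a \<in> h" "p \<in> h" | "p \<notin> h" | "a \<notin> h" "p \<in> h" by blast
    then show ?thesis
    proof cases
      case 1
      then have "insert a (g - {p}) \<inter> h = insert a (g \<inter> h - {p})" by auto
      then show ?thesis using sw[of "g \<inter> h"] 1 g f I[of g h] h by simp
    next
      case 2
      then have "g \<inter> h \<subseteq> insert a (g - {p}) \<inter> h" by auto
      then show ?thesis using I[of g h] g h f card_mono[of "insert a (g - {p}) \<inter> h" "g \<inter> h"] by fastforce
    next
      case 3
      then have "insert a (h - {p}) \<in> V" using h(2) by (auto simp: shift_def split: if_splits)
      moreover have "g \<inter> insert a (h - {p}) = insert a (g - {p}) \<inter> h" using 3 g by auto
      ultimately show ?thesis using I[of g "insert a (h - {p})"] g by simp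
    qed
  qed
  show ?thesis unfolding intersecting_def
  proof clarify
    fix g h assume gh: "g \<in> V" "h \<in> V"
    show "t \<le> card (shift p a V g \<inter> shift p a V h)"
    proof (cases "shift p a V g = g")
      case g: True
      show ?thesis
      proof (cases "shift p a V h = h")
        case True then show ?thesis using g I gh by simp
      next
        case False
        then have "shift p a V h = insert a (h - {p})" "p \<in> h" "a \<notin> h"
          by (auto simp: shift_def split: if_splits)
        then show ?thesis using moved[of h g] gh g by (simp add: Int_commute)
      qed
    next
      case False
      then have g: "shift p a V g = insert a (g - {p})" "p \<in> g" "a \<notin> g"
        by (auto simp: shift_def split: if_splits)
      show ?thesis
      proof (cases "shift p a V h = h")
        case True then show ?thesis using g moved[of g h] gh by simp
      next
        case False
        then have h: "shift p a V h = insert a (h - {p})" "p \<in> h" "a \<notin> h"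
          by (auto simp: shift_def split: if_splits)
        have "insert a (g - {p}) \<inter> insert a (h - {p}) = insert a (g \<inter> h - {p})" by auto
        then show ?thesis using g h I[of g h] gh sw[of "g \<inter> h"] assms(2) by simp
      qed
    qed
  qed
qed

text \<open>The score grows both when a set is added to the family and when \<open>p\<close> is exchanged for another
  element, so a family of maximal score is stable under both operations.\<close>
lemma stable_family:
  fixes f :: "nat \<Rightarrow> nat"
  assumes "U \<subseteq> Pow {..<Suc p}" "intersecting t U"
  obtains V where "V \<subseteq> Pow {..<Suc p}" "intersecting t V"
    "(\<Sum>g\<in>U. f (card g)) \<le> (\<Sum>g\<in>V. f (card g))"
    "\<And>g. g \<in> V \<Longrightarrow> insert p g \<in> V"
    "\<And>g a. g \<in> V \<Longrightarrow> p \<in> g \<Longrightarrow> a < p \<Longrightarrow> a \<notin> g \<Longrightarrow> insert a (g - {p}) \<in> V"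
proof -
  define Q where "Q = (\<lambda>V. V \<subseteq> Pow {..<Suc p} \<and> intersecting t V \<and>
    (\<Sum>g\<in>U. f (card g)) \<le> (\<Sum>g\<in>V. f (card g)))"
  \<comment> \<open>A new set adds at least 1; a set that loses \<open>p\<close> in a shift rises
    from 1 to 2.\<close>
  define score where "score = (\<lambda>V. \<Sum>g\<in>V. if p \<in> g then 1 else 2 :: nat)"
  have "finite {V. Q V}" by (rule finite_subset[of _ "Pow (Pow {..<Suc p})"]) (auto simp: Q_def)
  moreover have "Q U" using assms by (simp add: Q_def)
  ultimately have "Max (score ` {V. Q V}) \<in> score ` {V. Q V}" by (intro Max_in) auto
  then obtain V where V: "Q V" and "score V = Max (score ` {V. Q V})" by auto
  then have mx: "score V' \<le> score V" if "Q V'" for V'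
    using that \<open>finite {V. Q V}\<close> by simp
  have VP: "V \<subseteq> Pow {..<Suc p}" and Vi: "intersecting t V" using V by (auto simp: Q_def)
  have finV: "finite V" using VP by (meson finite_Pow_iff finite_lessThan finite_subset)
  have fing: "finite g" if "g \<in> V" for g
    using VP that by (meson PowD finite_lessThan finite_subset subsetD)
  show thesis
  proof
    show "V \<subseteq> Pow {..<Suc p}" "intersecting t V" "(\<Sum>g\<in>U. f (card g)) \<le> (\<Sum>g\<in>V. f (card g))"
      using V by (auto simp: Q_def)
  next
    fix g assume g: "g \<in> V"
    show "insert p g \<in> V"
    proof (rule ccontr)
      assume n: "insert p g \<notin> V"
      have up: "t \<le> card (insert p g \<inter> h) \<and> t \<le> card (h \<inter> insert p g)" if "h \<in> insert (insert p g) V" for h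
      proof -
        \<comment> \<open>Replacing the new set by its subset \<open>g\<close> reduces each pair to
          one within \<open>V\<close>.\<close>
        define h' where "h' = (if h = insert p g then g else h)"
        have "h' \<in> V" using that g by (auto simp: h'_def)
        then have "t \<le> card (g \<inter> h')" using Vi g unfolding intersecting_def by blast
        moreover have "g \<inter> h' \<subseteq> insert p g \<inter> h" by (auto simp: h'_def)
        moreover have "finite (insert p g \<inter> h)" using fing[OF g] by simp
        ultimately have "t \<le> card (insert p g \<inter> h)" using card_mono le_trans by blast
        then show ?thesis by (simp only: Int_commute)
      qed
      have "intersecting t (insert (insert p g) V)"
        using up Vi unfolding intersecting_def by blast
      then have "Q (insert (insert p g) V)" using V g n finV by (auto simp: Q_def)
      then show False using mx[of "insert (insert p g) V"] n finV by (simp add: score_def)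
    qed
  next
    fix g a assume g: "g \<in> V" "p \<in> g" "a < p" "a \<notin> g"
    show "insert a (g - {p}) \<in> V"
    proof (rule ccontr)
      assume n: "insert a (g - {p}) \<notin> V"
      let ?s = "shift p a V"
      have "?s ` V \<subseteq> Pow {..<Suc p}" using VP g(3) by (auto simp: shift_def subset_iff)
      moreover have "intersecting t (?s ` V)" using intersecting_shift[OF Vi fing] g(3) by simp
      moreover have "(\<Sum>g\<in>?s ` V. f (card g)) = (\<Sum>g\<in>V. f (card g))"
        using fing by (simp add: sum.reindex[OF inj_on_shift] card_shift)
      ultimately have "Q (?s ` V)" using V by (auto simp: Q_def)
      moreover have "score V < score (?s ` V)"
        unfolding score_def sum.reindex[OF inj_on_shift]
        using finV g n by (intro sum_strict_mono_ex1) (auto simp: shift_def)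
      ultimately show False using mx[of "?s ` V"] by simp
    qed
  qed
qed

section \<open>Removing the last point, and Wilson's theorem\<close>

text \<open>In a stable family the traces on \<open>{..<p}\<close> split into \<open>U0\<close>,
  occurring both with and without \<open>p\<close>, and \<open>D\<close>, occurring only with
  \<open>p\<close>. Dropping \<open>p\<close> can spoil intersections only between members of
  \<open>D\<close>, and there \<open>selection\<close> repairs them without loss of weight.\<close>

lemma truncation_step:
  assumes par: "1 \<le> t" "t \<le> p" "t \<le> k" "(t + 1) * (k - t + 1) \<le> m + p + 1"
    and U: "U \<subseteq> Pow {..<Suc p}" "intersecting t U"
  shows "\<exists>U'\<subseteq>Pow {..<p}. intersecting t U' \<and>
    (\<Sum>g\<in>U. ext_count k m (card g)) \<le> (\<Sum>g\<in>U'. ext_count k (Suc m) (card g))"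
proof -
  obtain V where V: "V \<subseteq> Pow {..<Suc p}" "intersecting t V"
    and le: "(\<Sum>g\<in>U. ext_count k m (card g)) \<le> (\<Sum>g\<in>V. ext_count k m (card g))"
    and up: "\<And>g. g \<in> V \<Longrightarrow> insert p g \<in> V"
    and sh: "\<And>g a. g \<in> V \<Longrightarrow> p \<in> g \<Longrightarrow> a < p \<Longrightarrow> a \<notin> g \<Longrightarrow> insert a (g - {p}) \<in> V"
    using stable_family[OF U, of "ext_count k m"] by metis
  have I: "t \<le> card (g \<inter> h)" if "g \<in> V" "h \<in> V" for g h
    using V(2) that by (auto simp: intersecting_def)
  define U0 where "U0 = {g\<in>V. p \<notin> g}"
  define D where "D = {g. g \<subseteq> {..<p} \<and> g \<notin> V \<and> insert p g \<in> V}"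
  have U0P: "U0 \<subseteq> Pow {..<p}" using V(1) unfolding U0_def lessThan_Suc by blast
  have DP: "D \<subseteq> Pow {..<p}" by (auto simp: D_def)
  have fin: "finite U0" "finite D"
    using U0P DP by (meson finite_Pow_iff finite_lessThan finite_subset)+
  have sub: "finite g" "p \<notin> g" if "g \<in> U0 \<union> D" for g
    using that U0P DP finite_subset[of g "{..<p}"] by auto
  have disj: "U0 \<inter> D = {}" by (auto simp: U0_def D_def)
  have conf: "t \<le> card (g \<inter> h) \<or> (g \<union> h = {..<p} \<and> card g + card h + 1 = p + t)"
    if "g \<in> D" "h \<in> D" for g h
  proof (rule disjCI)
    assume neg: "\<not> (g \<union> h = {..<p} \<and> card g + card h + 1 = p + t)"
    have gh: "g \<subseteq> {..<p}" "h \<subseteq> {..<p}" "insert p g \<in> V" "insert p h \<in> V"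
      using that by (auto simp: D_def)
    have f: "finite g" "finite h" "p \<notin> g" "p \<notin> h" using that sub by auto
    have c: "t \<le> Suc (card (g \<inter> h))" using I[OF gh(3,4)] f by simp
    show "t \<le> card (g \<inter> h)"
    proof (cases "g \<union> h = {..<p}")
      \<comment> \<open>The intersection has at least \<open>t - 1\<close> elements; exactly
        \<open>t - 1\<close> would give the size relation excluded by \<open>neg\<close>.\<close>
      case True
      then have "card g + card h = p + card (g \<inter> h)" using card_Un_Int[OF f(1,2)] by simp
      then show ?thesis using neg True c by linarith
    next
      case False
      \<comment> \<open>Exchanging \<open>p\<close> for a point outside both sets in one of the two
        members of \<open>V\<close> leaves just \<open>g \<inter> h\<close> as their
        intersection.\<close>
      then obtain a where a: "a < p" "a \<notin> g" "a \<notin> h" using gh by auto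
      have "insert a (insert p g - {p}) \<in> V" using sh[OF gh(3), of a] a by auto
      moreover have "insert a (insert p g - {p}) \<inter> insert p h = g \<inter> h" using a f by auto
      ultimately show ?thesis using I[of "insert a (insert p g - {p})" "insert p h"] gh by simp
    qed
  qed
  obtain D' where D': "D' \<subseteq> D" "intersecting t D'"
    "(\<Sum>g\<in>D. ext_count k m (Suc (card g))) \<le> (\<Sum>g\<in>D'. ext_count k (Suc m) (card g))"
    using selection[OF par DP conf] by blast
  have cross: "t \<le> card (g \<inter> h)" if "g \<in> U0" "h \<in> D" for g h
  proof -
    have "g \<inter> insert p h = g \<inter> h" using that by (auto simp: U0_def)
    then show ?thesis using I[of g "insert p h"] that by (simp add: U0_def D_def)
  qed
  have "intersecting t (U0 \<union> D')"
    using D'(1,2) cross I unfolding intersecting_def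
    by (metis (no_types, lifting) Int_commute U0_def Un_iff mem_Collect_eq subset_iff)
  moreover have "(\<Sum>g\<in>V. ext_count k m (card g)) \<le> (\<Sum>g\<in>U0 \<union> D'. ext_count k (Suc m) (card g))"
  proof -
    \<comment> \<open>Each \<open>g \<in> U0\<close> is counted twice, as \<open>g\<close> and as
      \<open>insert p g\<close>; Pascal's rule merges the two weights into
      \<open>ext_count k (Suc m) (card g)\<close>.\<close>
    have V_eq: "V = U0 \<union> insert p ` (U0 \<union> D)"
    proof
      show "V \<subseteq> U0 \<union> insert p ` (U0 \<union> D)"
      proof
        fix g assume g: "g \<in> V"
        show "g \<in> U0 \<union> insert p ` (U0 \<union> D)"
        proof (cases "p \<in> g")
          case True
          then have "g = insert p (g - {p})" "g - {p} \<subseteq> {..<p}" using g V(1) unfolding lessThan_Suc by blast+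
          then have "g - {p} \<in> U0 \<union> D" using g by (auto simp: U0_def D_def)
          then show ?thesis using \<open>g = insert p (g - {p})\<close> by blast
        qed (use g in \<open>simp add: U0_def\<close>)
      qed
    qed (use up in \<open>auto simp: U0_def D_def\<close>)
    have inj: "inj_on (insert p) (U0 \<union> D)"
      by (rule inj_onI) (use sub in \<open>metis insert_ident\<close>)
    have "(\<Sum>g\<in>V. ext_count k m (card g))
        = (\<Sum>g\<in>U0. ext_count k m (card g)) + (\<Sum>g\<in>insert p ` (U0 \<union> D). ext_count k m (card g))"
      unfolding V_eq using fin by (intro sum.union_disjoint) (auto simp: U0_def)
    also have "(\<Sum>g\<in>insert p ` (U0 \<union> D). ext_count k m (card g))
        = (\<Sum>g\<in>U0 \<union> D. ext_count k m (Suc (card g)))"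
      unfolding sum.reindex[OF inj] using sub by (intro sum.cong) auto
    also have "\<dots> = (\<Sum>g\<in>U0. ext_count k m (Suc (card g))) + (\<Sum>g\<in>D. ext_count k m (Suc (card g)))"
      using fin disj by (intro sum.union_disjoint)
    finally have "(\<Sum>g\<in>V. ext_count k m (card g))
        = (\<Sum>g\<in>U0. ext_count k (Suc m) (card g)) + (\<Sum>g\<in>D. ext_count k m (Suc (card g)))"
      by (simp add: ext_count_Suc sum.distrib)
    also have "\<dots> \<le> (\<Sum>g\<in>U0. ext_count k (Suc m) (card g)) + (\<Sum>g\<in>D'. ext_count k (Suc m) (card g))"
      using D'(3) by simp
    also have "\<dots> = (\<Sum>g\<in>U0 \<union> D'. ext_count k (Suc m) (card g))"
      using fin disj D'(1) by (intro sum.union_disjoint[symmetric]) (auto intro: finite_subset)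
    finally show ?thesis .
  qed
  ultimately show ?thesis using le D'(1) U0P DP by (intro exI[of _ "U0 \<union> D'"]) auto
qed

text \<open>Points are removed one at a time down to \<open>l = t\<close>. In each step
  \<open>m + p + 1\<close> equals \<open>n\<close>, so the size condition is the same
  throughout.\<close>

lemma weighted_intersecting_bound:
  assumes "1 \<le> t" "t \<le> k" "(t + 1) * (k - t + 1) \<le> n" "t \<le> l" "l \<le> n"
    and "U \<subseteq> Pow {..<l}" "intersecting t U"
  shows "(\<Sum>g\<in>U. ext_count k (n - l) (card g)) \<le> (n - t) choose (k - t)"
  using assms(4-)
proof (induction l arbitrary: U rule: dec_induct)
  case base
  have "U \<subseteq> {{..<t}}"
  proof
    fix g assume g: "g \<in> U"
    \<comment> \<open>The definition of \<open>intersecting\<close> includes the pair of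
      \<open>g\<close> with itself.\<close>
    then have "g \<subseteq> {..<t}" "t \<le> card (g \<inter> g)" using base by (auto simp only: intersecting_def)
    then show "g \<in> {{..<t}}" using card_seteq[of "{..<t}" g] by auto
  qed
  then have "(\<Sum>g\<in>U. ext_count k (n - t) (card g)) \<le> (\<Sum>g\<in>{{..<t}}. ext_count k (n - t) (card g))"
    by (intro sum_mono2) auto
  then show ?case using assms(2) by (simp add: ext_count_def)
next
  case (step p)
  have "n - p = Suc (n - Suc p)" using step.prems by simp
  moreover have "(t + 1) * (k - t + 1) \<le> (n - Suc p) + p + 1" using assms(3) step.prems by simp
  ultimately obtain U' where "U' \<subseteq> Pow {..<p}" "intersecting t U'"
    "(\<Sum>g\<in>U. ext_count k (n - Suc p) (card g)) \<le> (\<Sum>g\<in>U'. ext_count k (n - p) (card g))"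
    using truncation_step[of t p k "n - Suc p" U] assms step by auto
  then show ?case using step.IH[of U'] step.prems by simp
qed

text \<open>For \<open>t > 0\<close> this is the weighted bound at \<open>l = n\<close>, where no
  outside points remain and every \<open>k\<close>-set has weight 1. For \<open>t = 0\<close> it
  just counts all \<open>k\<close>-sets.\<close>

theorem intersecting_family_bound:
  assumes "t \<le> k" "(k - t + 1) * (t + 1) \<le> n"
    and F: "F \<subseteq> {g. g \<subseteq> {..<n} \<and> card g = k}" "intersecting t F"
  shows "card F \<le> (n - t) choose (k - t)"
proof (cases "t = 0")
  case True
  have "finite {g. g \<subseteq> {..<n} \<and> card g = k}" by (rule finite_subset[of _ "Pow {..<n}"]) auto
  then have "card F \<le> card {g. g \<subseteq> {..<n} \<and> card g = k}" using F(1) by (rule card_mono)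
  then show ?thesis using True by (simp add: n_subsets)
next
  case False
  have "t * 1 \<le> (t + 1) * (k - t + 1)" by (rule mult_mono) auto
  then have "t \<le> n" using assms(2) by (simp add: mult.commute)
  have "(\<Sum>g\<in>F. ext_count k (n - n) (card g)) \<le> (n - t) choose (k - t)"
    using False assms \<open>t \<le> n\<close>
    by (intro weighted_intersecting_bound) (auto simp: mult.commute)
  moreover have "(\<Sum>g\<in>F. ext_count k (n - n) (card g)) = card F"
    using F(1) by (subst sum.cong[of F F _ "\<lambda>_. 1"]) (auto simp: ext_count_def)
  ultimately show ?thesis by simp
qed

section \<open>Counting words by their supports\<close>

text \<open>Restriction to \<open>S\<close> is a bijection onto \<open>PiE S A\<close>, as the
  default value \<open>d\<close> determines the rest.\<close>

lemma card_functions_default: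
  assumes "finite S"
  shows "card {x. (\<forall>i\<in>S. x i \<in> A i) \<and> (\<forall>i. i \<notin> S \<longrightarrow> x i = d)} = (\<Prod>i\<in>S. card (A i))"
    (is "card ?X = _")
proof -
  have "bij_betw (\<lambda>x. restrict x S) ?X (PiE S A)"
    by (rule bij_betw_byWitness[where f' = "\<lambda>x i. if i \<in> S then x i else d"])
      (auto simp: fun_eq_iff PiE_iff extensional_def)
  then have "card ?X = card (PiE S A)" by (rule bij_betw_same_card)
  then show ?thesis unfolding card_PiE[OF assms] .
qed

lemma words_with_support:
  assumes "S \<subseteq> {..<n}" "0 < q"
  shows "{x\<in>words q n. supp n x = S} = {x. (\<forall>i\<in>S. x i \<in> {1..<q}) \<and> (\<forall>i. i \<notin> S \<longrightarrow> x i = 0)}"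
proof (intro set_eqI iffI)
  fix x assume "x \<in> {x. (\<forall>i\<in>S. x i \<in> {1..<q}) \<and> (\<forall>i. i \<notin> S \<longrightarrow> x i = 0)}"
  then have "\<forall>i\<in>S. 1 \<le> x i \<and> x i < q" "\<forall>i. i \<notin> S \<longrightarrow> x i = 0" by auto
  then show "x \<in> {x\<in>words q n. supp n x = S}"
    using assms by (auto simp: words_def supp_def)
next
  fix x assume "x \<in> {x\<in>words q n. supp n x = S}"
  then show "x \<in> {x. (\<forall>i\<in>S. x i \<in> {1..<q}) \<and> (\<forall>i. i \<notin> S \<longrightarrow> x i = 0)}"
    using assms by (auto simp: words_def supp_def)
qed

lemma finite_words_with_support:
  assumes "S \<subseteq> {..<n}" "0 < q"
  shows "finite {x\<in>words q n. supp n x = S}"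
proof -
  have "finite S" using assms(1) finite_subset by blast
  then have "finite {x. \<forall>i. (i \<in> S \<longrightarrow> x i \<in> {1..<q}) \<and> (i \<notin> S \<longrightarrow> x i = 0)}"
    by (intro finite_set_of_finite_funs) auto
  then show ?thesis unfolding words_with_support[OF assms] by (rule rev_finite_subset) auto
qed

lemma card_words_with_support:
  assumes "S \<subseteq> {..<n}" "0 < q"
  shows "card {x\<in>words q n. supp n x = S} = (q - 1) ^ card S"
proof -
  have "finite S" using assms(1) finite_subset by blast
  then show ?thesis unfolding words_with_support[OF assms] by (subst card_functions_default) auto
qed

text \<open>Union bound over the position of agreement: fixing one letter leaves
  \<open>card S - 1\<close> free nonzero letters.\<close>

lemma card_words_agreeing:
  assumes S: "S \<subseteq> {..<n}" and q: "0 < q"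
  shows "card {y\<in>words q n. supp n y = S \<and> (\<exists>i\<in>S. y i = x i)} \<le> card S * (q - 1) ^ (card S - 1)"
proof -
  have fin: "finite S" using S finite_subset by blast
  have one: "card {y\<in>words q n. supp n y = S \<and> y i = x i} \<le> (q - 1) ^ (card S - 1)" if i: "i \<in> S" for i
  proof -
    \<comment> \<open>If \<open>x i\<close> is not a nonzero letter, pinning position
      \<open>i\<close> to it still gives a superset, which suffices for an upper bound.\<close>
    define A where "A = (\<lambda>j. if j = i then {x i} else {1..<q})"
    let ?Y = "{y. (\<forall>j\<in>S. y j \<in> A j) \<and> (\<forall>j. j \<notin> S \<longrightarrow> y j = 0)}"
    have prod: "(\<Prod>j\<in>S. card (A j)) = (q - 1) ^ (card S - 1)"
      using prod.remove[OF fin i, of "\<lambda>j. card (A j)"] fin i by (simp add: A_def)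
    have "finite {y. \<forall>j. (j \<in> S \<longrightarrow> y j \<in> insert (x i) {1..<q}) \<and> (j \<notin> S \<longrightarrow> y j = 0)}"
      using fin by (intro finite_set_of_finite_funs) auto
    then have "finite ?Y" by (rule rev_finite_subset) (auto simp: A_def split: if_splits)
    moreover have "{y\<in>words q n. supp n y = S \<and> y i = x i}
        = {y\<in>{y\<in>words q n. supp n y = S}. y i = x i}" by auto
    then have "{y\<in>words q n. supp n y = S \<and> y i = x i} \<subseteq> ?Y"
      unfolding words_with_support[OF S q] by (auto simp: A_def)
    ultimately have "card {y\<in>words q n. supp n y = S \<and> y i = x i} \<le> card ?Y" by (rule card_mono)
    then show ?thesis unfolding card_functions_default[OF fin] prod .
  qed
  have "{y\<in>words q n. supp n y = S \<and> (\<exists>i\<in>S. y i = x i)}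
      = (\<Union>i\<in>S. {y\<in>words q n. supp n y = S \<and> y i = x i})" by auto
  also have "card \<dots> \<le> (\<Sum>i\<in>S. card {y\<in>words q n. supp n y = S \<and> y i = x i})"
    by (rule card_UN_le[OF fin])
  also have "\<dots> \<le> (\<Sum>i\<in>S. (q - 1) ^ (card S - 1))" by (rule sum_mono[OF one])
  finally show ?thesis by simp
qed

section \<open>Distances and the upper bound for anticodes\<close>

lemma finite_supp: "finite (supp n x)"
  by (simp add: supp_def)

text \<open>Differing positions lie in the union of the supports. The additive form avoids truncated
  subtraction.\<close>

lemma hdist_le:
  assumes "wt n x = w" "wt n y = w"
  shows "hdist n x y + card (supp n x \<inter> supp n y) \<le> 2 * w"
proof -
  have "hdist n x y \<le> card (supp n x \<union> supp n y)" unfolding hdist_def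
    by (rule card_mono) (auto simp: supp_def)
  then show ?thesis using card_Un_Int[of "supp n x" "supp n y"] assms by (simp add: finite_supp wt_def)
qed

text \<open>Now every position in the union of the supports differs: on \<open>supp n y\<close> by
  hypothesis, elsewhere because only \<open>x\<close> is nonzero.\<close>

lemma hdist_eq_if_no_agreement:
  assumes "wt n x = w" "wt n y = w" "\<And>i. i \<in> supp n y \<Longrightarrow> y i \<noteq> x i"
  shows "hdist n x y + card (supp n x \<inter> supp n y) = 2 * w"
proof -
  have "{i. i < n \<and> x i \<noteq> y i} = supp n x \<union> supp n y"
    using assms(3) by (fastforce simp: supp_def)
  then show ?thesis using card_Un_Int[of "supp n x" "supp n y"] assms by (simp add: finite_supp wt_def hdist_def)
qed

lemma card_eq_sum_over_supports:
  assumes "finite X" "finite \<S>" "\<And>x. x \<in> X \<Longrightarrow> supp n x \<in> \<S>"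
  shows "card X = (\<Sum>S\<in>\<S>. card {x\<in>X. supp n x = S})"
  using sum.group[OF assms(1,2), of "supp n" "\<lambda>_. 1::nat"] assms(3)
  by (simp add: image_subset_iff)

lemma finite_Jq:
  assumes "0 < q"
  shows "finite (Jq q n w)"
proof (rule finite_subset)
  show "Jq q n w \<subseteq> (\<Union>S\<in>Pow {..<n}. {x\<in>words q n. supp n x = S})"
    by (auto simp: Jq_def supp_def)
  show "finite (\<Union>S\<in>Pow {..<n}. {x\<in>words q n. supp n x = S})"
    using finite_words_with_support assms by simp
qed

text \<open>Call a support dense if it carries more words of the anticode than could agree somewhere with
  a given word. Every word of the anticode then has a word on each dense support with which it never
  agrees, so its support meets every dense support in at least \<open>t\<close> positions. Hence the dense supports
  form a \<open>t\<close>-intersecting family, and if that family has maximum size, there are no other supports.\<close>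
lemma card_anticode_le:
  assumes tw: "t \<le> w" and n: "(w - t + 1) * (t + 1) \<le> n" and q: "w * (n choose w) < q"
    and T: "anticode n (Jq q n w) (2 * w - t) T"
  shows "card T \<le> ((n - t) choose (w - t)) * (q - 1) ^ w"
proof -
  define M where "M = (n - t) choose (w - t)"
  define \<S> where "\<S> = {S. S \<subseteq> {..<n} \<and> card S = w}"
  define fib where "fib = (\<lambda>S. {x\<in>T. supp n x = S})"
  define \<D> where "\<D> = {S\<in>\<S>. w * (q - 1) ^ (w - 1) < card (fib S)}"
  have q0: "0 < q" using q by simp
  have TJ: "T \<subseteq> Jq q n w" and dist: "\<And>x y. x \<in> T \<Longrightarrow> y \<in> T \<Longrightarrow> hdist n x y \<le> 2 * w - t"
    using T by (auto simp: anticode_def)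
  have finT: "finite T" using TJ finite_Jq[OF q0] finite_subset by blast
  have T_words: "x \<in> words q n" "wt n x = w" if "x \<in> T" for x using that TJ by (auto simp: Jq_def)
  have T_supp: "supp n x \<in> \<S>" if "x \<in> T" for x
    using T_words[OF that] by (auto simp: \<S>_def wt_def supp_def)
  have fin\<S>: "finite \<S>" by (rule finite_subset[of _ "Pow {..<n}"]) (auto simp: \<S>_def)
  have card\<S>: "card \<S> = n choose w" using n_subsets[of "{..<n}" w] by (simp add: \<S>_def)
  have \<D>\<S>: "\<D> \<subseteq> \<S>" by (auto simp: \<D>_def)
  have fin\<D>: "finite \<D>" using \<D>\<S> fin\<S> finite_subset by blast
  have fib_le: "card (fib S) \<le> (q - 1) ^ w" if "S \<in> \<S>" for S
  proof -
    have S: "S \<subseteq> {..<n}" "card S = w" using that by (auto simp: \<S>_def)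
    have "fib S \<subseteq> {x\<in>words q n. supp n x = S}" using T_words by (auto simp: fib_def)
    then show ?thesis
      using card_mono[OF finite_words_with_support[OF S(1) q0]] card_words_with_support[OF S(1) q0] S by fastforce
  qed
  have meet: "t \<le> card (supp n x \<inter> S)" if x: "x \<in> T" and "S \<in> \<D>" for x S
  proof -
    have S: "S \<subseteq> {..<n}" "card S = w" "w * (q - 1) ^ (w - 1) < card (fib S)"
      using \<open>S \<in> \<D>\<close> by (auto simp: \<D>_def \<S>_def)
    let ?B = "{y\<in>words q n. supp n y = S \<and> (\<exists>i\<in>S. y i = x i)}"
    have "finite ?B" by (rule finite_subset[OF _ finite_words_with_support[OF S(1) q0]]) auto
    then have "\<not> fib S \<subseteq> ?B"
      using card_mono[of ?B "fib S"] card_words_agreeing[OF S(1) q0, of x] S(2,3) by auto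
    then obtain y where y: "y \<in> T" "supp n y = S" "\<And>i. i \<in> S \<Longrightarrow> y i \<noteq> x i"
      using T_words unfolding fib_def by blast
    then have "hdist n x y + card (supp n x \<inter> S) = 2 * w"
      using hdist_eq_if_no_agreement[of n x w y] T_words x by auto
    then show ?thesis using dist[OF x y(1)] tw by linarith
  qed
  have dense_word: "\<exists>x\<in>T. supp n x = S" if "S \<in> \<D>" for S
  proof -
    have "fib S \<noteq> {}" using that by (auto simp: \<D>_def)
    then show ?thesis by (auto simp: fib_def)
  qed
  have intD: "intersecting t \<D>"
    unfolding intersecting_def using meet dense_word by metis
  have cardD: "card \<D> \<le> M"
    unfolding M_def using \<D>\<S> by (intro intersecting_family_bound[OF tw n _ intD]) (auto simp: \<S>_def)
  have "card T = (\<Sum>S\<in>\<S>. card (fib S))"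
    unfolding fib_def using card_eq_sum_over_supports[OF finT fin\<S>] T_supp by blast
  also have "\<dots> = (\<Sum>S\<in>\<S> - \<D>. card (fib S)) + (\<Sum>S\<in>\<D>. card (fib S))"
    by (rule sum.subset_diff[OF \<D>\<S> fin\<S>])
  also have "\<dots> \<le> M * (q - 1) ^ w"
  proof -
    have D: "(\<Sum>S\<in>\<D>. card (fib S)) \<le> card \<D> * (q - 1) ^ w"
      using sum_bounded_above[of \<D> "\<lambda>S. card (fib S)" "(q - 1) ^ w"] fib_le \<D>\<S> by auto
    show ?thesis
    proof (cases "card \<D> = M")
      case True
      have "supp n x \<in> \<D>" if x: "x \<in> T" for x
      proof (rule ccontr)
        assume "supp n x \<notin> \<D>"
        have "t \<le> card (supp n x)" using T_words[OF x] tw by (simp add: wt_def)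
        then have "intersecting t (insert (supp n x) \<D>)"
          using intD meet[OF x] unfolding intersecting_def by (metis Int_commute Int_absorb insert_iff)
        then have "card (insert (supp n x) \<D>) \<le> M"
          unfolding M_def using \<D>\<S> T_supp[OF x]
          by (intro intersecting_family_bound[OF tw n]) (auto simp: \<S>_def)
        then show False using True fin\<D> \<open>supp n x \<notin> \<D>\<close> by simp
      qed
      then have "fib S = {}" if "S \<in> \<S> - \<D>" for S using that by (auto simp: fib_def)
      then show ?thesis using D True by simp
    next
      case False
      \<comment> \<open>With fewer than \<open>M\<close> dense supports, a spare
        \<open>(q - 1) ^ w\<close> must absorb all other fibres. Each has at most
        \<open>w * (q - 1) ^ (w - 1)\<close> words, and
        \<open>w * (n choose w) \<le> q - 1\<close>.\<close>
      have "(\<Sum>S\<in>\<S> - \<D>. card (fib S)) \<le> card (\<S> - \<D>) * (w * (q - 1) ^ (w - 1))"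
      proof -
        have "(\<Sum>S\<in>\<S> - \<D>. card (fib S)) \<le> (\<Sum>S\<in>\<S> - \<D>. w * (q - 1) ^ (w - 1))"
          by (rule sum_mono) (auto simp: \<D>_def not_less)
        then show ?thesis by simp
      qed
      also have "\<dots> \<le> (n choose w) * (w * (q - 1) ^ (w - 1))"
        using card_mono[of \<S> "\<S> - \<D>"] fin\<S> card\<S> by (intro mult_right_mono) auto
      also have "\<dots> \<le> (q - 1) ^ w"
      \<comment> \<open>For \<open>w = 0\<close> the exponent \<open>w - 1\<close> is truncated, but
        the left side is 0.\<close>
      proof (cases w)
        case (Suc v)
        have "(w * (n choose w)) * (q - 1) ^ v \<le> (q - 1) * (q - 1) ^ v"
          using q by (intro mult_right_mono) auto
        moreover have "w - 1 = v" "(q - 1) ^ w = (q - 1) * (q - 1) ^ v" by (simp_all add: Suc)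
        ultimately show ?thesis by (simp only: ac_simps)
      qed simp
      finally have "(\<Sum>S\<in>\<S> - \<D>. card (fib S)) + (\<Sum>S\<in>\<D>. card (fib S)) \<le> Suc (card \<D>) * (q - 1) ^ w"
        using D by simp
      also have "\<dots> \<le> M * (q - 1) ^ w" using cardD False by (intro mult_right_mono) auto
      finally show ?thesis .
    qed
  qed
  finally show ?thesis by (simp add: M_def)
qed

section \<open>The anticode \<open>Aprime\<close>\<close>

lemma card_supersets_of_size:
  assumes "t \<le> w" "t \<le> n"
  shows "card {S. {..<t} \<subseteq> S \<and> S \<subseteq> {..<n} \<and> card S = w} = (n - t) choose (w - t)" (is "card ?X = _")
proof -
  let ?Y = "{S. S \<subseteq> {t..<n} \<and> card S = w - t}"
  have "bij_betw (\<lambda>S. {..<t} \<union> S) ?Y ?X"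
  proof (rule bij_betw_byWitness[where f' = "\<lambda>S. S - {..<t}"])
    show "(\<lambda>S. {..<t} \<union> S) ` ?Y \<subseteq> ?X"
    proof clarify
      fix S assume S: "S \<subseteq> {t..<n}" "card S = w - t"
      then have "finite S" "{..<t} \<inter> S = {}" using finite_subset by auto
      then have "card ({..<t} \<union> S) = w" using S assms by (simp add: card_Un_disjoint)
      then show "{..<t} \<subseteq> {..<t} \<union> S \<and> {..<t} \<union> S \<subseteq> {..<n} \<and> card ({..<t} \<union> S) = w"
        using S assms by auto
    qed
    show "(\<lambda>S. S - {..<t}) ` ?X \<subseteq> ?Y" by (auto simp: card_Diff_subset)
  qed auto
  then show ?thesis using bij_betw_same_card n_subsets[of "{t..<n}" "w - t"] by fastforce
qed

text \<open>The two counting conditions become conditions on the support alone: \<open>t\<close>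
  nonzero entries among the first \<open>t\<close> positions means that all of them are
  nonzero.\<close>

lemma Aprime_eq:
  assumes "t \<le> w" "t \<le> n"
  shows "Aprime q n w t = {x\<in>words q n. {..<t} \<subseteq> supp n x \<and> card (supp n x) = w}"
proof -
  have "card {i. i < t \<and> x i \<noteq> 0} = t \<and> card {i. t \<le> i \<and> i < n \<and> x i \<noteq> 0} = w - t
      \<longleftrightarrow> {..<t} \<subseteq> supp n x \<and> card (supp n x) = w" for x :: "nat \<Rightarrow> nat"
  proof -
    let ?A = "{i. i < t \<and> x i \<noteq> 0}" and ?B = "{i. t \<le> i \<and> i < n \<and> x i \<noteq> 0}"
    have "supp n x = ?A \<union> ?B" using assms(2) by (auto simp: supp_def)
    then have c: "card (supp n x) = card ?A + card ?B" by (simp add: card_Un_disjoint disjoint_iff)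
    have "card ?A = t \<longleftrightarrow> ?A = {..<t}"
    proof
      assume "card ?A = t"
      then show "?A = {..<t}" by (intro card_subset_eq) auto
    next
      assume "?A = {..<t}"
      then show "card ?A = t" by (simp only: card_lessThan)
    qed
    also have "\<dots> \<longleftrightarrow> {..<t} \<subseteq> supp n x"
    proof
      assume "?A = {..<t}"
      moreover have "?A \<subseteq> supp n x" using assms(2) by (auto simp: supp_def)
      ultimately show "{..<t} \<subseteq> supp n x" by (simp only:)
    next
      assume "{..<t} \<subseteq> supp n x"
      then show "?A = {..<t}" by (auto simp: supp_def)
    qed
    finally have "card ?A = t \<longleftrightarrow> {..<t} \<subseteq> supp n x" .
    moreover have "card ?B = w - t \<longleftrightarrow> card (supp n x) = w" if "card ?A = t"
      using c assms(1) that by linarith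
    ultimately show ?thesis by blast
  qed
  then show ?thesis by (auto simp: Aprime_def)
qed

lemma card_Aprime:
  assumes "t \<le> w" "t \<le> n" "0 < q"
  shows "card (Aprime q n w t) = ((n - t) choose (w - t)) * (q - 1) ^ w"
proof -
  let ?X = "{S. {..<t} \<subseteq> S \<and> S \<subseteq> {..<n} \<and> card S = w}"
  note A = Aprime_eq[OF assms(1,2)]
  have "finite ?X" by (rule finite_subset[of _ "Pow {..<n}"]) auto
  moreover have "finite (Aprime q n w t)"
    by (rule finite_subset[OF _ finite_Jq[OF assms(3), of n w]]) (auto simp: A Jq_def wt_def)
  ultimately have "card (Aprime q n w t) = (\<Sum>S\<in>?X. card {x\<in>Aprime q n w t. supp n x = S})"
    by (intro card_eq_sum_over_supports) (auto simp: A, auto simp: supp_def)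
  also have "\<dots> = (\<Sum>S\<in>?X. (q - 1) ^ w)"
  proof (rule sum.cong[OF refl])
    fix S assume S: "S \<in> ?X"
    then have "{x\<in>Aprime q n w t. supp n x = S} = {x\<in>words q n. supp n x = S}" by (auto simp: A)
    then show "card {x\<in>Aprime q n w t. supp n x = S} = (q - 1) ^ w"
      using S card_words_with_support[of S n q] assms(3) by simp
  qed
  also have "\<dots> = ((n - t) choose (w - t)) * (q - 1) ^ w"
    by (simp add: card_supersets_of_size[OF assms(1,2)])
  finally show ?thesis .
qed

text \<open>All supports share \<open>{..<t}\<close>, which bounds the distance; nonemptiness
  follows from the positive cardinality.\<close>

lemma anticode_Aprime:
  assumes "t \<le> w" "w \<le> n" "2 \<le> q"
  shows "anticode n (Jq q n w) (2 * w - t) (Aprime q n w t)"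
proof -
  have "t \<le> n" using assms by simp
  note A = Aprime_eq[OF assms(1) this]
  have "card (Aprime q n w t) > 0" using assms \<open>t \<le> n\<close> by (simp add: card_Aprime)
  then have "Aprime q n w t \<noteq> {}" by auto
  moreover have "Aprime q n w t \<subseteq> Jq q n w" by (auto simp: A Jq_def wt_def)
  moreover have "hdist n x y \<le> 2 * w - t" if "x \<in> Aprime q n w t" "y \<in> Aprime q n w t" for x y
  proof -
    have "{..<t} \<subseteq> supp n x \<inter> supp n y" using that by (auto simp: A)
    then have "t \<le> card (supp n x \<inter> supp n y)"
      using card_mono[of "supp n x \<inter> supp n y" "{..<t}"] finite_supp by auto
    then show ?thesis using hdist_le[of n x w y] that by (simp add: A wt_def)
  qed
  ultimately show ?thesis by (auto simp: anticode_def)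
qed

theorem mainTheorem3:
  fixes n w t :: nat
  assumes "t \<le> w" and "t \<le> 2 * w - t" and "2 * w - t \<le> n"
  shows "(\<forall>q\<ge>3. card (Aprime q n w t) = ((n - t) choose (w - t)) * (q - 1) ^ w
                  \<and> anticode n (Jq q n w) (2 * w - t) (Aprime q n w t))
         \<and> ((w - t + 1) * (t + 1) \<le> n \<longrightarrow>
             (\<exists>q0. \<forall>q\<ge>q0. q \<ge> 3 \<longrightarrow> max_anticode n (Jq q n w) (2 * w - t) (Aprime q n w t)))"
proof (intro conjI allI impI)
  \<comment> \<open>From \<open>t \<le> w\<close> one gets
    \<open>w \<le> 2 * w - t \<le> n\<close>.\<close>
  have tn: "t \<le> n" "w \<le> n" using assms by linarith+
  fix q :: nat assume "3 \<le> q"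
  then show "card (Aprime q n w t) = ((n - t) choose (w - t)) * (q - 1) ^ w"
    "anticode n (Jq q n w) (2 * w - t) (Aprime q n w t)"
    using card_Aprime anticode_Aprime assms(1) tn by auto
next
  have tn: "t \<le> n" "w \<le> n" using assms by linarith+
  assume n: "(w - t + 1) * (t + 1) \<le> n"
  show "\<exists>q0. \<forall>q\<ge>q0. q \<ge> 3 \<longrightarrow> max_anticode n (Jq q n w) (2 * w - t) (Aprime q n w t)"
  proof (intro exI allI impI)
    \<comment> \<open>This threshold for \<open>q\<close> is the one at which the sparse supports
      are absorbed in \<open>card_anticode_le\<close>.\<close>
    fix q assume "Suc (w * (n choose w)) \<le> q" "3 \<le> q"
    then show "max_anticode n (Jq q n w) (2 * w - t) (Aprime q n w t)"
      unfolding max_anticode_def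
      using card_anticode_le[OF assms(1) n, of q] card_Aprime[OF assms(1) tn(1), of q]
        anticode_Aprime[OF assms(1) tn(2), of q] by simp
  qed
qed

end
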